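(* Let $N\ge 0$ be an integer. Every non-redundant algorithm that solves a normal binary decision problem with solution set $\{0,1,\dots,N\}$ and experiments at the integers $1,\dots,N$ can be represented by a full binary search tree, i.e., by a full binary tree with $N$ inner nodes and $N+1$ leaves such that the inorder (symmetric order, left to right) traversal of its nodes carries the labels $$\boxed{0},\ (1),\ \boxed{1},\ (2),\ \boxed{2},\ \dots,\ \boxed{N-1},\ (N),\ \boxed{N},$$ where the inner nodes carry the labels $(1),\dots,(N)$ and the leaves carry the labels $\boxed{0},\dots,\boxed{N}$.
   Context: A binary decision problem on integers is one in which the algorithm performs, at each stage, a binary decision called an experiment at an integer $x$, with outcome success or failure. The problem is normal if: (1) (complete) the solution set is the set of integers between $0$ and some finite $N$ inclusive, and every solution is possible and constitutes an instance of the problem; (2) (partition) if an experiment is performed at an integer $x$, success indicates that the solution is in $[x,N]$ and failure indicates that the solution is in $[0,x-1]$. An integer $x^*$ is the solution if both: $x^*=0$ or experiment $x^*$ is a success; and $x^*=N$ or experiment $x^*+1$ is a failure. An algorithm chooses experiments deterministically from the outcomes of the previous experiments. It solves the problem if it is finite and arrives at the solution for every instance. It is non-redundant if it performs no experiment that is guaranteed to succeed or guaranteed to fail (given the outcomes of the experiments already performed). A full binary tree is one in which every node has either $0$ children (a leaf) or $2$ children (an inner node); the smallest binary tree consists of a single root node. A label $(x)$ on an inner node indicates that an experiment is to be performed at $x$; on failure one proceeds to the left child and on success to the right child. A label $\boxed{x}$ on a leaf indicates that the algorithm terminates with the conclusion that the solution is $x$. A tree represents an algorithm if, on every instance, following the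 tree from the root performs exactly the experiments of the algorithm, in the same order, and ends at a leaf whose label is the conclusion of the algorithm. *)

theory Defs
  imports Main
begin

text \<open>
  A binary decision problem is given by a set \<open>I\<close> of instances and a function \<open>outcome\<close>:
  \<open>outcome i x\<close> says whether the experiment at \<open>x\<close> succeeds on the instance \<open>i\<close>.
  Only the experiments at \<open>1, \<dots>, N\<close> belong to the problem; the values of \<open>outcome i\<close> at other
  integers are irrelevant and nothing is assumed about them. The range condition in
  \<open>is_solution\<close> keeps these values from entering the definition.
\<close>

definition is_solution :: "int \<Rightarrow> (int \<Rightarrow> bool) \<Rightarrow> int \<Rightarrow> bool" where
  "is_solution N oc x \<longleftrightarrow>
     x \<in> {0..N} \<and> (x = 0 \<or> oc x) \<and> (x = N \<or> \<not> oc (x + 1))"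

definition normal_problem :: "int \<Rightarrow> 'i set \<Rightarrow> ('i \<Rightarrow> int \<Rightarrow> bool) \<Rightarrow> bool" where
  "normal_problem N I outcome \<longleftrightarrow>
     {s. \<exists>i\<in>I. is_solution N (outcome i) s} = {0..N} \<and>
     (\<forall>i\<in>I. \<forall>x\<in>{1..N}. \<forall>s. is_solution N (outcome i) s \<longrightarrow>
        (outcome i x \<longrightarrow> s \<in> {x..N}) \<and> (\<not> outcome i x \<longrightarrow> s \<in> {0..x - 1}))"

text \<open>
  That every instance has exactly one solution is not part of the definition of a normal problem,
  but follows from it.
\<close>

lemma ex_is_solution:
  assumes "0 \<le> N"
  shows "\<exists>s. is_solution N oc s"
proof -
  define S where "S = {x \<in> {0..N}. x = 0 \<or> oc x}"
  have fin: "finite S"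
    unfolding S_def by (rule finite_subset[of _ "{0..N}"]) auto
  have ne: "S \<noteq> {}"
    using assms by (auto simp: S_def)
  have mem: "Max S \<in> S"
    using fin ne by (rule Max_in)
  have "Max S = N \<or> \<not> oc (Max S + 1)"
  proof (rule ccontr)
    assume "\<not> ?thesis"
    with mem have "Max S + 1 \<in> S"
      by (auto simp: S_def)
    with fin have "Max S + 1 \<le> Max S"
      by (rule Max_ge)
    then show False by simp
  qed
  with mem show ?thesis
    by (auto simp: is_solution_def S_def)
qed

lemma normal_problem_ex1_solution:
  assumes "0 \<le> N" and "normal_problem N I outcome" and "i \<in> I"
  shows "\<exists>!s. is_solution N (outcome i) s"
proof -
  have le: "t \<le> s" if s: "is_solution N (outcome i) s" and t: "is_solution N (outcome i) t" for s t
  proof (cases "t = 0")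
    case True
    with s show ?thesis by (simp add: is_solution_def)
  next
    case False
    with t have "t \<in> {1..N}" "outcome i t"
      by (auto simp: is_solution_def)
    with assms s have "s \<in> {t..N}"
      unfolding normal_problem_def by blast
    then show ?thesis by simp
  qed
  from ex_is_solution[OF assms(1)] obtain s where "is_solution N (outcome i) s" ..
  with le show ?thesis by (blast intro: order.antisym)
qed

text \<open>
  \<open>Experiment x\<close> is the label $(x)$ and \<open>Conclude x\<close> is the boxed label $x$. A history lists the
  experiments performed so far with their outcomes, in chronological order. Only the values of an
  algorithm at histories that occur on some instance matter.
\<close>

datatype action = Experiment int | Conclude int

type_synonym history = "(int \<times> bool) list"
type_synonym algorithm = "history \<Rightarrow> action"

inductive reaches :: "algorithm \<Rightarrow> (int \<Rightarrow> bool) \<Rightarrow> history \<Rightarrow> bool"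
  for A :: algorithm and oc :: "int \<Rightarrow> bool" where
  start: "reaches A oc []"
| step: "reaches A oc h \<Longrightarrow> A h = Experiment x \<Longrightarrow> reaches A oc (h @ [(x, oc x)])"

definition halts_with :: "algorithm \<Rightarrow> (int \<Rightarrow> bool) \<Rightarrow> history \<Rightarrow> int \<Rightarrow> bool" where
  "halts_with A oc h c \<longleftrightarrow> reaches A oc h \<and> A h = Conclude c"

definition performs_only :: "'i set \<Rightarrow> ('i \<Rightarrow> int \<Rightarrow> bool) \<Rightarrow> int set \<Rightarrow> algorithm \<Rightarrow> bool" where
  "performs_only I outcome X A \<longleftrightarrow>
     (\<forall>i\<in>I. \<forall>h x. reaches A (outcome i) h \<and> A h = Experiment x \<longrightarrow> x \<in> X)"

definition solves :: "int \<Rightarrow> 'i set \<Rightarrow> ('i \<Rightarrow> int \<Rightarrow> bool) \<Rightarrow> algorithm \<Rightarrow> bool" where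
  "solves N I outcome A \<longleftrightarrow>
     (\<forall>i\<in>I. \<exists>h s. halts_with A (outcome i) h s \<and> is_solution N (outcome i) s)"

definition consistent :: "'i set \<Rightarrow> ('i \<Rightarrow> int \<Rightarrow> bool) \<Rightarrow> history \<Rightarrow> 'i set" where
  "consistent I outcome h = {j \<in> I. \<forall>(x, b)\<in>set h. outcome j x = b}"

definition non_redundant :: "'i set \<Rightarrow> ('i \<Rightarrow> int \<Rightarrow> bool) \<Rightarrow> algorithm \<Rightarrow> bool" where
  "non_redundant I outcome A \<longleftrightarrow>
     (\<forall>i\<in>I. \<forall>h x. reaches A (outcome i) h \<and> A h = Experiment x \<longrightarrow>
        \<not> (\<forall>j\<in>consistent I outcome h. outcome j x) \<and>
        \<not> (\<forall>j\<in>consistent I outcome h. \<not> outcome j x))"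

text \<open>Trees of this type are full: each node has either no child or two children.\<close>

datatype dtree = Leaf int | Node dtree int dtree

fun num_inner :: "dtree \<Rightarrow> nat" where
  "num_inner (Leaf c) = 0"
| "num_inner (Node l x r) = num_inner l + 1 + num_inner r"

fun num_leaves :: "dtree \<Rightarrow> nat" where
  "num_leaves (Leaf c) = 1"
| "num_leaves (Node l x r) = num_leaves l + num_leaves r"

fun inorder_labels :: "dtree \<Rightarrow> action list" where
  "inorder_labels (Leaf c) = [Conclude c]"
| "inorder_labels (Node l x r) = inorder_labels l @ [Experiment x] @ inorder_labels r"

fun tree_experiments :: "(int \<Rightarrow> bool) \<Rightarrow> dtree \<Rightarrow> int list" where
  "tree_experiments oc (Leaf c) = []"
| "tree_experiments oc (Node l x r) = x # tree_experiments oc (if oc x then r else l)"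

fun tree_conclusion :: "(int \<Rightarrow> bool) \<Rightarrow> dtree \<Rightarrow> int" where
  "tree_conclusion oc (Leaf c) = c"
| "tree_conclusion oc (Node l x r) = tree_conclusion oc (if oc x then r else l)"

definition represents :: "'i set \<Rightarrow> ('i \<Rightarrow> int \<Rightarrow> bool) \<Rightarrow> dtree \<Rightarrow> algorithm \<Rightarrow> bool" where
  "represents I outcome t A \<longleftrightarrow>
     (\<forall>i\<in>I. \<exists>h. halts_with A (outcome i) h (tree_conclusion (outcome i) t) \<and>
        map fst h = tree_experiments (outcome i) t)"

end

theory Submission imports Defs begin

text \<open>
  In a normal problem an instance is, for all purposes, its solution \<open>s\<close>: the experiment at \<open>x\<close>
  succeeds iff \<open>x \<le> s\<close> (lemma \<open>outcome_iff_le_solution\<close>). Hence the instances that agree with a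
  history are always those whose solution lies in some interval \<open>{a..b}\<close>, and each integer of this
  interval is the solution of one of them. There are two cases for what the algorithm does next.

  If it stops, its single conclusion must be right for every solution in \<open>{a..b}\<close>, so \<open>a = b\<close>.
  If it performs an experiment at \<open>x\<close>, non-redundancy provides one remaining instance that fails
  and one that succeeds, so \<open>a < x \<le> b\<close>; failure leaves \<open>{a..x - 1}\<close> and success leaves \<open>{x..b}\<close>,
  both nonempty and both shorter than \<open>{a..b}\<close>.

  By induction on the length of the interval, the behaviour from this history onwards is a full
  binary tree, and its inorder traversal lists \<open>a\<close> and then, for each \<open>x\<close> in \<open>{a + 1..b}\<close>, the
  experiment at \<open>x\<close> and the conclusion \<open>x\<close> (lemma \<open>ex_search_subtree\<close>): the root \<open>x\<close> separates the
  traversals for \<open>{a..x - 1}\<close> and \<open>{x..b}\<close>. The empty history has the interval \<open>{0..N}\<close>.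

  Termination is thus a consequence of non-redundancy. That the algorithm solves the problem is
  needed for the correctness of its conclusions: it promises one correct halting run per instance,
  and as the algorithm is deterministic, there is no other (lemma \<open>halts_with_unique\<close>).
\<close>

section \<open>Determinism of runs\<close>

lemma reaches_append_ConsD:
  "reaches A oc (h @ (y, b) # k) \<Longrightarrow> A h = Experiment y \<and> b = oc y"
proof (induction k rule: rev_induct)
  case Nil
  then show ?case by (cases rule: reaches.cases) auto
next
  case (snoc e k)
  from snoc.prems have "reaches A oc (h @ (y, b) # k)"
    by (cases rule: reaches.cases) auto
  then show ?case by (rule snoc.IH)
qed

text \<open>
  A halting run cannot be left before its end, since its next experiment is prescribed, nor be
  continued beyond its end.
\<close>

lemma reaches_prefix_of_halting:
  assumes "reaches A oc h'" and "halts_with A oc h c"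
  shows "\<exists>k. h = h' @ k"
  using assms(1)
proof induction
  case start
  then show ?case by simp
next
  case (step h' x)
  then obtain k where k: "h = h' @ k" by blast
  with step.hyps assms(2) have "k \<noteq> []"
    by (auto simp: halts_with_def)
  then obtain y b k' where "k = (y, b) # k'"
    by (metis neq_Nil_conv surj_pair)
  with k assms(2) have "A h' = Experiment y \<and> b = oc y"
    by (auto simp: halts_with_def dest: reaches_append_ConsD)
  with step.hyps k \<open>k = (y, b) # k'\<close> show ?case by auto
qed

lemma halts_with_unique:
  assumes "halts_with A oc h c" and "halts_with A oc h' c'"
  shows "c = c'"
proof -
  have "\<exists>k. h = h' @ k" "\<exists>k. h' = h @ k"
    using assms by (auto intro!: reaches_prefix_of_halting simp: halts_with_def)
  then have "h = h'" by auto
  with assms show ?thesis by (simp add: halts_with_def)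
qed

section \<open>Instances as solutions\<close>

lemma outcome_iff_le_solution:
  assumes "normal_problem N I outcome" and "i \<in> I"
    and "is_solution N (outcome i) s" and "x \<in> {1..N}"
  shows "outcome i x \<longleftrightarrow> x \<le> s"
proof -
  have "(outcome i x \<longrightarrow> s \<in> {x..N}) \<and> (\<not> outcome i x \<longrightarrow> s \<in> {0..x - 1})"
    using assms unfolding normal_problem_def by blast
  then show ?thesis by auto
qed

section \<open>Trees that an algorithm follows\<close>

text \<open>
  The version of \<^const>\<open>represents\<close> for one instance and for an algorithm that has already
  performed the experiments in \<open>h\<close>, so that it can be proved by recursion on the tree.
\<close>

definition follows :: "algorithm \<Rightarrow> (int \<Rightarrow> bool) \<Rightarrow> history \<Rightarrow> dtree \<Rightarrow> bool" where
  "follows A oc h t \<longleftrightarrow>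
     (\<exists>k. halts_with A oc (h @ k) (tree_conclusion oc t) \<and> map fst k = tree_experiments oc t)"

lemma represents_iff_follows:
  "represents I outcome t A \<longleftrightarrow> (\<forall>i\<in>I. follows A (outcome i) [] t)"
  by (simp add: represents_def follows_def)

lemma follows_Leaf: "halts_with A oc h c \<Longrightarrow> follows A oc h (Leaf c)"
  by (auto simp: follows_def)

lemma follows_Node:
  assumes "follows A oc (h @ [(x, oc x)]) (if oc x then r else l)"
  shows "follows A oc h (Node l x r)"
proof -
  from assms obtain k
    where "halts_with A oc ((h @ [(x, oc x)]) @ k) (tree_conclusion oc (if oc x then r else l))"
      and "map fst k = tree_experiments oc (if oc x then r else l)"
    unfolding follows_def by blast
  then show ?thesis
    unfolding follows_def by (intro exI[of _ "(x, oc x) # k"]) simp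
qed

section \<open>Inorder traversals\<close>

definition search_labels :: "int \<Rightarrow> int \<Rightarrow> action list" where
  "search_labels a b = Conclude a # concat (map (\<lambda>x. [Experiment x, Conclude x]) [a + 1..b])"

lemma search_labels_singleton: "search_labels a a = [Conclude a]"
  by (simp add: search_labels_def)

lemma search_labels_split:
  assumes "a < x" and "x \<le> b"
  shows "search_labels a b = search_labels a (x - 1) @ [Experiment x] @ search_labels x b"
proof -
  have "[a + 1..b] = [a + 1..x - 1] @ x # [x + 1..b]"
    using assms by (intro upto_split3) auto
  then show ?thesis by (simp add: search_labels_def)
qed

lemma length_search_labels:
  assumes "a \<le> b"
  shows "int (length (search_labels a b)) = 2 * (b - a) + 1"
proof -
  have "length (concat (map (\<lambda>x. [Experiment x, Conclude x]) xs)) = 2 * length xs" for xs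
    by (induction xs) auto
  with assms show ?thesis by (simp add: search_labels_def)
qed

lemma num_leaves_eq: "num_leaves t = num_inner t + 1"
  by (induction t) auto

lemma length_inorder_labels: "length (inorder_labels t) = num_inner t + num_leaves t"
  by (induction t) auto

section \<open>The search tree\<close>

text \<open>
  The function \<open>\<sigma>\<close> assigns to each instance its solution. At the history \<open>h\<close> the instances still
  possible are those with solution in \<open>{a..b}\<close>, and all of them do lead to \<open>h\<close>. Both facts pass
  to the two histories that extend \<open>h\<close> by one experiment, and the interval shrinks.
\<close>

lemma ex_search_subtree:
  assumes outcome: "\<And>i x. i \<in> I \<Longrightarrow> x \<in> {1..N} \<Longrightarrow> outcome i x \<longleftrightarrow> x \<le> \<sigma> i"
    and range: "\<sigma> ` I = {0..N}"
    and only: "performs_only I outcome {1..N} A"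
    and nonred: "non_redundant I outcome A"
    and correct: "\<And>i h c. i \<in> I \<Longrightarrow> halts_with A (outcome i) h c \<Longrightarrow> c = \<sigma> i"
    and "0 \<le> a" "a \<le> b" "b \<le> N"
    and reach: "\<And>i. i \<in> I \<Longrightarrow> \<sigma> i \<in> {a..b} \<Longrightarrow> reaches A (outcome i) h"
    and cons: "consistent I outcome h = {i \<in> I. \<sigma> i \<in> {a..b}}"
  shows "\<exists>t. inorder_labels t = search_labels a b \<and>
             (\<forall>i\<in>I. \<sigma> i \<in> {a..b} \<longrightarrow> follows A (outcome i) h t)"
  using assms(6-)
proof (induction "nat (b - a)" arbitrary: a b h rule: less_induct)
  case less
  note reach = less.prems(4) and cons = less.prems(5)
  have ex: "\<exists>i\<in>I. \<sigma> i = s" if "s \<in> {a..b}" for s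
  proof -
    from that less.prems(1,3) have "s \<in> \<sigma> ` I" by (simp add: range)
    then show ?thesis by auto
  qed
  show ?case
  proof (cases "A h")
    case (Conclude c)
    have halt: "halts_with A (outcome i) h c" if "i \<in> I" "\<sigma> i \<in> {a..b}" for i
      using reach[OF that] Conclude by (simp add: halts_with_def)
    have all: "s = c" if "s \<in> {a..b}" for s
      using ex[OF that] halt correct that by metis
    have "a = c" "b = c"
      using all[of a] all[of b] less.prems(2) by auto
    with halt show ?thesis
      by (intro exI[of _ "Leaf c"]) (auto simp: search_labels_singleton intro: follows_Leaf)
  next
    case (Experiment x)
    obtain i0 where i0: "i0 \<in> I" "\<sigma> i0 \<in> {a..b}"
      using ex[of a] less.prems(2) by auto
    have x: "x \<in> {1..N}"
      using only i0 reach Experiment unfolding performs_only_def by blast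
    have "\<not> (\<forall>j\<in>consistent I outcome h. outcome j x)"
      and "\<not> (\<forall>j\<in>consistent I outcome h. \<not> outcome j x)"
      using nonred i0 reach Experiment unfolding non_redundant_def by blast+
    then obtain j k where "j \<in> I" "\<sigma> j \<in> {a..b}" "\<not> outcome j x"
      and "k \<in> I" "\<sigma> k \<in> {a..b}" "outcome k x"
      unfolding cons by blast
    with outcome x have ax: "a < x" and xb: "x \<le> b" by force+
    have reach': "reaches A (outcome i) (h @ [(x, outcome i x)])"
      if "i \<in> I" "\<sigma> i \<in> {a..b}" for i
      using reach[OF that] Experiment by (rule reaches.step)
    have cons': "consistent I outcome (h @ [(x, v)]) = {i \<in> consistent I outcome h. outcome i x = v}"
      for v by (auto simp: consistent_def)
    have "\<exists>l. inorder_labels l = search_labels a (x - 1) \<and>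
        (\<forall>i\<in>I. \<sigma> i \<in> {a..x - 1} \<longrightarrow> follows A (outcome i) (h @ [(x, False)]) l)"
    proof (rule less.hyps)
      show "reaches A (outcome i) (h @ [(x, False)])" if "i \<in> I" "\<sigma> i \<in> {a..x - 1}" for i
        using reach'[of i] that outcome[OF that(1) x] xb by simp
      show "consistent I outcome (h @ [(x, False)]) = {i \<in> I. \<sigma> i \<in> {a..x - 1}}"
        using xb outcome x by (auto simp: cons' cons)
    qed (use less.prems ax xb in auto)
    then obtain l where l: "inorder_labels l = search_labels a (x - 1)"
      "\<And>i. i \<in> I \<Longrightarrow> \<sigma> i \<in> {a..x - 1} \<Longrightarrow> follows A (outcome i) (h @ [(x, False)]) l"
      by blast
    have "\<exists>r. inorder_labels r = search_labels x b \<and>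
        (\<forall>i\<in>I. \<sigma> i \<in> {x..b} \<longrightarrow> follows A (outcome i) (h @ [(x, True)]) r)"
    proof (rule less.hyps)
      show "reaches A (outcome i) (h @ [(x, True)])" if "i \<in> I" "\<sigma> i \<in> {x..b}" for i
        using reach'[of i] that outcome[OF that(1) x] ax by simp
      show "consistent I outcome (h @ [(x, True)]) = {i \<in> I. \<sigma> i \<in> {x..b}}"
        using ax outcome x by (auto simp: cons' cons)
    qed (use less.prems ax xb in auto)
    then obtain r where r: "inorder_labels r = search_labels x b"
      "\<And>i. i \<in> I \<Longrightarrow> \<sigma> i \<in> {x..b} \<Longrightarrow> follows A (outcome i) (h @ [(x, True)]) r"
      by blast
    have "follows A (outcome i) h (Node l x r)" if "i \<in> I" "\<sigma> i \<in> {a..b}" for i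
    proof (rule follows_Node)
      show "follows A (outcome i) (h @ [(x, outcome i x)]) (if outcome i x then r else l)"
        using l(2)[of i] r(2)[of i] that outcome[OF that(1) x] by (cases "outcome i x") auto
    qed
    moreover have "inorder_labels (Node l x r) = search_labels a b"
      using l(1) r(1) search_labels_split[OF ax xb] by simp
    ultimately show ?thesis by blast
  qed
qed

theorem theorem2p7:
  fixes N :: int
    and I :: "'i set"
    and outcome :: "'i \<Rightarrow> int \<Rightarrow> bool"
    and A :: algorithm
  assumes "N \<ge> 0"
    and "normal_problem N I outcome"
    and "performs_only I outcome {1..N} A"
    and "solves N I outcome A"
    and "non_redundant I outcome A"
  shows "\<exists>t :: dtree.
           represents I outcome t A \<and>
           int (num_inner t) = N \<and>
           int (num_leaves t) = N + 1 \<and>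
           inorder_labels t =
             Conclude 0 # concat (map (\<lambda>x. [Experiment x, Conclude x]) [1..N])"
proof -
  define \<sigma> where "\<sigma> i = (THE s. is_solution N (outcome i) s)" for i
  have unique: "\<exists>!s. is_solution N (outcome i) s" if "i \<in> I" for i
    using assms(1,2) that by (rule normal_problem_ex1_solution)
  have \<sigma>: "is_solution N (outcome i) s \<longleftrightarrow> s = \<sigma> i" if "i \<in> I" for i s
    using theI'[OF unique[OF that]] unique[OF that] unfolding \<sigma>_def by blast
  have "{s. \<exists>i\<in>I. is_solution N (outcome i) s} = {0..N}"
    using assms(2) by (simp add: normal_problem_def)
  then have range: "\<sigma> ` I = {0..N}"
    using \<sigma> by auto
  have outcome: "outcome i x \<longleftrightarrow> x \<le> \<sigma> i" if "i \<in> I" "x \<in> {1..N}" for i x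
    using outcome_iff_le_solution[OF assms(2) that(1) _ that(2)] \<sigma>[OF that(1)] by blast
  have correct: "c = \<sigma> i" if "i \<in> I" "halts_with A (outcome i) h c" for i h c
  proof -
    obtain h' s where "halts_with A (outcome i) h' s" "is_solution N (outcome i) s"
      using assms(4) \<open>i \<in> I\<close> unfolding solves_def by blast
    with halts_with_unique[OF that(2)] \<sigma>[OF that(1)] show ?thesis by blast
  qed
  have "\<exists>t. inorder_labels t = search_labels 0 N \<and>
      (\<forall>i\<in>I. \<sigma> i \<in> {0..N} \<longrightarrow> follows A (outcome i) [] t)"
  proof (rule ex_search_subtree[OF outcome range assms(3,5) correct])
    show "consistent I outcome [] = {i \<in> I. \<sigma> i \<in> {0..N}}"
      using range by (auto simp: consistent_def)
  qed (use assms(1) in \<open>auto intro: reaches.start\<close>)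
  then obtain t where labels: "inorder_labels t = search_labels 0 N"
    and t: "\<forall>i\<in>I. \<sigma> i \<in> {0..N} \<longrightarrow> follows A (outcome i) [] t"
    by blast
  have "represents I outcome t A"
    using t unfolding represents_iff_follows range[symmetric] by blast
  moreover have "int (num_inner t + num_leaves t) = 2 * N + 1"
    using length_search_labels[OF assms(1)] by (simp add: labels flip: length_inorder_labels)
  then have "int (num_inner t) = N" "int (num_leaves t) = N + 1"
    by (auto simp: num_leaves_eq)
  ultimately show ?thesis
    using labels by (auto simp: search_labels_def)
qed

end
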